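(* Let $k,d,n$ be positive integers, $B_w,B_x>0$, and let $V_W\subseteq\mathbb{R}^k$ be a fixed linear subspace with $\dim(V_W)=r_w$. Define $$\mathcal{W}=\{W\in\mathbb{R}^{k\times d}:\ \operatorname{col}(W)\subseteq V_W,\ \|W\|_{2\to2}\le B_w\},\qquad \mathcal{F}^{(2\to2)}=\{f_W:x\mapsto Wx:\ W\in\mathcal{W}\}.$$ Suppose the inputs $x_1,\dots,x_n\in\mathbb{R}^d$ satisfy $\|x_i\|_2\le B_x$ for $i=1,\dots,n$. Then, for every $\epsilon>0$, $$\log\mathcal{N}_\infty\left(\mathcal{F}^{(2\to2)},\epsilon,n,\|\cdot\|_2\right)\le r_w d\,\log\left(1+\frac{2B_wB_x}{\epsilon}\right).$$
   Context: $\operatorname{col}(W)$ is the column space of $W$, and $\|W\|_{2\to2}=\sup_{x\neq0}\|Wx\|_2/\|x\|_2$ is the operator norm. Covering numbers: for a class $\mathcal{F}$ of functions $\mathbb{R}^d\to\mathbb{R}^k$, $\epsilon>0$ and points $x_1,\dots,x_n$, $\mathcal{N}_\infty(\mathcal{F},\epsilon,\{x_i\},\|\cdot\|_2)$ is the smallest $m$ for which there exist functions $f_1,\dots,f_m:\mathbb{R}^d\to\mathbb{R}^k$ such that for every $f\in\mathcal{F}$, $\min_{j\in[m]}\max_{i\in[n]}\|f(x_i)-f_j(x_i)\|_2\le\epsilon$. The quantity $\mathcal{N}_\infty(\mathcal{F},\epsilon,n,\|\cdot\|_2)$ is the supremum of $\mathcal{N}_\infty(\mathcal{F},\epsilon,\{x_i\},\|\cdot\|_2)$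 over all samples $x_1,\dots,x_n$ of size $n$ satisfying the stated norm constraint on the inputs (here $\|x_i\|_2\le B_x$). *)

theory Defs
  imports "HOL-Analysis.Analysis"
begin

text \<open>
  The cover functions \<open>g j\<close> are arbitrary; they need not belong to \<open>F\<close>. The condition
  \<open>min\<^sub>j max\<^sub>i \<dots> \<le> \<epsilon>\<close> is written as \<open>\<exists>j. \<forall>i. \<dots> \<le> \<epsilon>\<close>,
  so that the empty family covers only the empty class.
\<close>

definition is_cover ::
  "('a \<Rightarrow> 'b::real_normed_vector) set \<Rightarrow> real \<Rightarrow> nat \<Rightarrow> (nat \<Rightarrow> 'a) \<Rightarrow> nat \<Rightarrow> (nat \<Rightarrow> 'a \<Rightarrow> 'b) \<Rightarrow> bool"
  where "is_cover F \<epsilon> n x m g \<longleftrightarrow>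
    (\<forall>f\<in>F. \<exists>j\<in>{1..m}. \<forall>i\<in>{1..n}. norm (f (x i) - g j (x i)) \<le> \<epsilon>)"

text \<open>The value is \<open>\<infinity>\<close> if no finite cover exists.\<close>

definition covering_number_on ::
  "('a \<Rightarrow> 'b::real_normed_vector) set \<Rightarrow> real \<Rightarrow> nat \<Rightarrow> (nat \<Rightarrow> 'a) \<Rightarrow> enat"
  where "covering_number_on F \<epsilon> n x = Inf {enat m | m. \<exists>g. is_cover F \<epsilon> n x m g}"

definition covering_number ::
  "('a::real_normed_vector \<Rightarrow> 'b::real_normed_vector) set \<Rightarrow> real \<Rightarrow> nat \<Rightarrow> real \<Rightarrow> enat"
  where "covering_number F \<epsilon> n B\<^sub>x =
    Sup (covering_number_on F \<epsilon> n ` {x. \<forall>i\<in>{1..n}. norm (x i) \<le> B\<^sub>x})"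

text \<open>Natural logarithm on the extended naturals, so that a bound on it includes finiteness.\<close>

fun ln_enat :: "enat \<Rightarrow> ereal"
  where
    "ln_enat (enat m) = (if m = 0 then - \<infinity> else ereal (ln (real m)))"
  | "ln_enat \<infinity> = \<infinity>"

text \<open>
  \<open>onorm f\<close> is the supremum of \<open>norm (f x) / norm x\<close> over all \<open>x\<close>; the point
  \<open>x = 0\<close> contributes \<open>0 / 0 = 0\<close> and so does not affect it.
\<close>

definition weight_class :: "(real^'k) set \<Rightarrow> real \<Rightarrow> (real^'d^'k) set"
  where "weight_class V B\<^sub>w = {W. span (columns W) \<subseteq> V \<and> onorm ((*v) W) \<le> B\<^sub>w}"

definition linear_class :: "(real^'k) set \<Rightarrow> real \<Rightarrow> (real^'d \<Rightarrow> real^'k) set"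
  where "linear_class V B\<^sub>w = {(\<lambda>x. W *v x) | W. W \<in> weight_class V B\<^sub>w}"

end

theory Submission
  imports Defs
begin

text \<open>
  The matrices with columns in \<open>V\<^sub>W\<close> form a space of dimension at most \<open>r\<^sub>w d\<close>. In that space a
  maximal \<open>\<delta>\<close>-separated subset of the operator-norm ball of radius \<open>B\<^sub>w\<close> is a \<open>\<delta>\<close>-net, and it has at
  most \<open>(1 + 2 B\<^sub>w / \<delta>)\<close> to the dimension many points, because the balls of radius \<open>\<delta> / 2\<close> around
  them are disjoint and lie in the ball of radius \<open>B\<^sub>w + \<delta> / 2\<close>. Take \<open>\<delta> = \<epsilon> / B\<^sub>x\<close>.
\<close>

section \<open>Volume bound for separated sets\<close>

text \<open>The diagonal map that multiplies the coordinates in \<open>D\<close> by \<open>t\<close>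
  has determinant \<open>t ^ card D\<close>. \<open>KL\<close> presents \<open>K\<close> as the
  preimage of \<open>L\<close> under this map, the form in which a push-forward of
  \<open>lborel\<close> measures \<open>L\<close>.\<close>

lemma measure_lborel_scale_coordinates:
  fixes D :: "'a::euclidean_space set"
  assumes D: "D \<subseteq> Basis" and t: "t > 0"
    and L: "L \<in> sets borel"
    and KL: "\<And>x. (\<Sum>j\<in>Basis. ((if j \<in> D then t else 1) * (x \<bullet> j)) *\<^sub>R j) \<in> L \<longleftrightarrow> x \<in> K"
  shows "measure lborel L = t ^ card D * measure lborel K"
proof -
  define c where "c j = (if j \<in> D then t else 1)" for j
  \<comment> \<open>The summand \<open>0\<close> is the translation part of the affine map in
    \<open>lborel_affine_euclidean\<close>, kept so that the rule matches.\<close>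
  define T where "T x = 0 + (\<Sum>j\<in>Basis. (c j * (x \<bullet> j)) *\<^sub>R j)" for x :: 'a
  have T: "T \<in> borel_measurable borel"
    unfolding T_def by measurable
  have "prod c Basis = prod c D"
    by (intro prod.mono_neutral_right) (use D in \<open>auto simp: c_def\<close>)
  then have c: "(\<Prod>j\<in>Basis. \<bar>c j\<bar>) = t ^ card D"
    using t by (simp add: c_def if_distrib[of abs] cong: if_cong)
  have "emeasure lborel L = emeasure (density (distr lborel borel T) (\<lambda>_. \<Prod>j\<in>Basis. \<bar>c j\<bar>)) L"
    unfolding T_def by (subst lborel_affine_euclidean[of c 0]) (use t in \<open>auto simp: c_def\<close>)
  also have "\<dots> = t ^ card D * emeasure (distr lborel borel T) L"
    unfolding c using L by (simp add: emeasure_density nn_integral_cmult)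
  also have "emeasure (distr lborel borel T) L = emeasure lborel (T -` L)"
    using T L by (simp add: emeasure_distr)
  also have "T -` L = K"
    unfolding vimage_def T_def c_def add_0_left KL by simp
  finally show ?thesis
    using t by (simp add: measure_def enn2real_mult)
qed

text \<open>A proper coordinate subspace is a null set of the ambient space, so volumes are compared
  for sets thickened in the other coordinates. For these sets \<open>upper\<close> yields closedness
  (through continuity of \<open>\<nu>\<close>) and positive volume, and \<open>lower\<close> yields
  boundedness.\<close>

lemma separated_set_card_le_coordinate:
  fixes \<nu> :: "'a::euclidean_space \<Rightarrow> real"
  assumes D: "D \<subseteq> Basis" and S: "S = {x. \<forall>i\<in>Basis. i \<notin> D \<longrightarrow> x \<bullet> i = 0}"
    and tri: "\<And>x y. \<nu> (x + y) \<le> \<nu> x + \<nu> y"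
    and scale: "\<And>a x. \<nu> (a *\<^sub>R x) = \<bar>a\<bar> * \<nu> x"
    and upper: "\<And>x. \<nu> x \<le> C * norm x"
    and c: "c > 0" and lower: "\<And>x. x \<in> S \<Longrightarrow> c * norm x \<le> \<nu> x"
    and P: "finite P" "P \<subseteq> S" "\<And>x. x \<in> P \<Longrightarrow> \<nu> x \<le> R"
    and sep: "\<And>x y. x \<in> P \<Longrightarrow> y \<in> P \<Longrightarrow> x \<noteq> y \<Longrightarrow> \<nu> (x - y) > \<delta>"
    and \<delta>: "\<delta> > 0" and R: "R \<ge> 0"
  shows "real (card P) \<le> (1 + 2 * R / \<delta>) ^ card D"
proof -
  define prj where "prj x = (\<Sum>j\<in>D. (x \<bullet> j) *\<^sub>R j)" for x :: 'a
  \<comment> \<open>The \<open>t\<close>-ball of \<open>\<nu>\<close> in \<open>S\<close>, thickened by a fixed box in the remaining coordinates to have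
    positive volume; dilating only the coordinates in \<open>D\<close> makes the volume scale as \<open>t ^ card D\<close>.\<close>
  define K where "K t = {x. \<nu> (prj x) \<le> t} \<inter> (\<Inter>j\<in>Basis - D. {x. \<bar>x \<bullet> j\<bar> \<le> 1})" for t
  have fD: "finite D"
    using D by (rule finite_subset) simp
  have prj_inner: "prj x \<bullet> j = (if j \<in> D then x \<bullet> j else 0)" if "j \<in> Basis" for x j
  proof -
    have "prj x \<bullet> j = (\<Sum>i\<in>D. if i = j then x \<bullet> j else 0)"
      unfolding prj_def inner_sum_left
      by (rule sum.cong) (use D that in \<open>auto simp: inner_Basis\<close>)
    then show ?thesis
      using fD by simp
  qed
  have prj_in: "prj x \<in> S" for x
    by (auto simp: S prj_inner)
  have prj_id: "prj x = x" if "x \<in> S" for x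
    by (rule euclidean_eqI) (use that in \<open>auto simp: prj_inner S\<close>)
  have prj_add: "prj (x + y) = prj x + prj y" for x y
    by (simp add: prj_def inner_add_left scaleR_left_distrib sum.distrib)
  have prj_cont: "continuous_on UNIV prj"
    unfolding prj_def by (intro continuous_intros)
  have prj_norm: "norm (prj x) \<le> norm x" for x
    by (rule norm_le_componentwise) (simp add: prj_inner)
  have nu0: "\<nu> 0 = 0"
    using scale[of 0 0] by simp
  have minus: "\<nu> (- x) = \<nu> x" for x
    using scale[of "-1" x] by simp
  have nonneg: "\<nu> x \<ge> 0" for x
    using tri[of x "- x"] by (simp add: nu0 minus)
  have C: "C \<ge> 0"
  proof -
    obtain b :: 'a where "b \<in> Basis"
      using nonempty_Basis by blast
    then show ?thesis
      using upper[of b] nonneg[of b] by simp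
  qed
  \<comment> \<open>The reverse triangle inequality combined with \<open>upper\<close>.\<close>
  have "\<bar>\<nu> x - \<nu> y\<bar> \<le> C * dist x y" for x y
    using tri[of "x - y" y] tri[of "y - x" x] minus[of "x - y"] upper[of "x - y"]
    by (simp add: dist_norm)
  then have "C-lipschitz_on UNIV \<nu>"
    using C by (simp add: lipschitz_on_def dist_real_def)
  then have "continuous_on UNIV \<nu>"
    by (rule lipschitz_on_continuous_on)
  then have cont: "continuous_on UNIV (\<lambda>x. \<nu> (prj x))"
    using prj_cont continuous_on_compose2 by blast
  have closed: "closed (K t)" for t
    unfolding K_def
    by (intro closed_Int closed_INT ballI closed_Collect_le cont continuous_intros)
  have bounded: "bounded (K t)" for t
  proof (rule boundedI)
    fix x assume x: "x \<in> K t"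
    have "norm x \<le> (\<Sum>j\<in>Basis. \<bar>x \<bullet> j\<bar>)"
      by (rule norm_le_l1)
    also have "\<dots> \<le> (\<Sum>j\<in>(Basis::'a set). \<bar>t\<bar> / c + 1)"
    proof (rule sum_mono)
      fix j :: 'a assume j: "j \<in> Basis"
      show "\<bar>x \<bullet> j\<bar> \<le> \<bar>t\<bar> / c + 1"
      proof (cases "j \<in> D")
        case True
        have "c * \<bar>x \<bullet> j\<bar> \<le> c * norm (prj x)"
          using Basis_le_norm[OF j, of "prj x"] c True by (simp add: prj_inner j)
        also have "\<dots> \<le> \<bar>t\<bar>"
          using lower[OF prj_in, of x] x by (auto simp: K_def)
        finally have "\<bar>x \<bullet> j\<bar> \<le> \<bar>t\<bar> / c"
          using c by (simp add: field_simps)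
        then show ?thesis by simp
      next
        case False
        then have "\<bar>x \<bullet> j\<bar> \<le> 1"
          using x j by (auto simp: K_def)
        moreover have "\<bar>t\<bar> / c \<ge> 0"
          using c by simp
        ultimately show ?thesis by linarith
      qed
    qed
    finally show "norm x \<le> (\<Sum>j\<in>(Basis::'a set). \<bar>t\<bar> / c + 1)" .
  qed
  have meas: "K t \<in> lmeasurable" for t
    using closed bounded by (simp add: lmeasurable_compact compact_eq_bounded_closed)
  have K_scale: "measure lebesgue (K t) = t ^ card D * measure lebesgue (K 1)" if t: "t > 0" for t
  proof -
    have "measure lborel (K t) = t ^ card D * measure lborel (K 1)"
    proof (rule measure_lborel_scale_coordinates[OF D t])
      fix x
      let ?T = "\<Sum>j\<in>Basis. ((if j \<in> D then t else 1) * (x \<bullet> j)) *\<^sub>R j"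
      have T: "?T \<bullet> j = (if j \<in> D then t else 1) * (x \<bullet> j)" if "j \<in> Basis" for j
        using that by simp
      have "prj ?T = t *\<^sub>R prj x"
        by (rule euclidean_eqI) (use T in \<open>simp add: prj_inner\<close>)
      then show "?T \<in> K t \<longleftrightarrow> x \<in> K 1"
        using t T by (simp add: K_def scale)
    qed (use closed in auto)
    then show ?thesis
      using closed by (simp add: measure_completion)
  qed
  have K1: "measure lebesgue (K 1) > 0"
  proof -
    \<comment> \<open>A radius small enough for both constraints in \<open>K 1\<close>; adding 1 to
      \<open>C\<close> covers the case \<open>C = 0\<close> and gives
      \<open>r \<le> 1\<close>.\<close>
    define r where "r = 1 / (C + 1)"
    have r: "r > 0" "r \<le> 1" "C * r \<le> 1"
      using C by (auto simp: r_def field_simps)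
    have "cball 0 r \<subseteq> K 1"
    proof
      fix x :: 'a assume "x \<in> cball 0 r"
      then have x: "norm x \<le> r" by simp
      have "\<nu> (prj x) \<le> C * norm (prj x)"
        by (rule upper)
      also have "\<dots> \<le> C * r"
        using prj_norm[of x] x C by (intro mult_left_mono) auto
      finally have "\<nu> (prj x) \<le> 1"
        using r by simp
      moreover have "\<bar>x \<bullet> j\<bar> \<le> 1" if "j \<in> Basis" for j
        using Basis_le_norm[OF that, of x] x r by linarith
      ultimately show "x \<in> K 1"
        by (simp add: K_def)
    qed
    then have "measure lebesgue (cball (0::'a) r) \<le> measure lebesgue (K 1)"
      using meas by (intro measure_mono_fmeasurable) auto
    moreover have "measure lebesgue (cball (0::'a) r) > 0"
      using content_cball_pos[OF r(1), of "0::'a"] by (simp add: measure_completion)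
    ultimately show ?thesis by linarith
  qed
  let ?M = "\<lambda>x. (+) x ` K (\<delta> / 2)"
  have disj: "?M x \<inter> ?M y = {}" if xy: "x \<in> P" "y \<in> P" "x \<noteq> y" for x y
  proof (rule ccontr)
    assume "?M x \<inter> ?M y \<noteq> {}"
    then obtain u v where u: "u \<in> K (\<delta> / 2)" and v: "v \<in> K (\<delta> / 2)" and uv: "x + u = y + v"
      by auto
    \<comment> \<open>Projecting a common point discards the box coordinates and fixes
      \<open>x\<close> and \<open>y\<close>, so \<open>x - y\<close> is a difference of two vectors
      of seminorm at most \<open>\<delta> / 2\<close>.\<close>
    have "x + prj u = y + prj v"
      using arg_cong[OF uv, of prj] xy P(2) by (auto simp: prj_add prj_id subset_iff)
    then have "x - y = prj v + - prj u"
      by (simp add: algebra_simps)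
    then have "\<nu> (x - y) \<le> \<nu> (prj v) + \<nu> (prj u)"
      by (metis tri minus)
    also have "\<dots> \<le> \<delta>"
      using u v by (simp add: K_def)
    finally show False
      using sep[OF xy] by simp
  qed
  \<comment> \<open>Points of \<open>S\<close> vanish outside \<open>D\<close>, so translation by
    them leaves the box in place and only the radius grows.\<close>
  have sub: "?M x \<subseteq> K (R + \<delta> / 2)" if x: "x \<in> P" for x
  proof
    fix z assume "z \<in> ?M x"
    then obtain u where u: "u \<in> K (\<delta> / 2)" and z: "z = x + u"
      by auto
    have xS: "x \<in> S"
      using x P(2) by blast
    have "\<nu> (prj z) \<le> \<nu> x + \<nu> (prj u)"
      unfolding z prj_add prj_id[OF xS] by (rule tri)
    then show "z \<in> K (R + \<delta> / 2)"
      using P(3)[OF x] u xS by (auto simp: K_def z S inner_add_left)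
  qed
  have "card P * measure lebesgue (K (\<delta> / 2)) = (\<Sum>x\<in>P. measure lebesgue (?M x))"
    by (simp add: measure_translation)
  also have "\<dots> = measure lebesgue (\<Union>x\<in>P. ?M x)"
    using P(1) disj meas
    by (subst measure_negligible_finite_Union_image)
       (auto simp: pairwise_def measurable_translation)
  also have "\<dots> \<le> measure lebesgue (K (R + \<delta> / 2))"
    using sub meas P(1)
    by (intro measure_mono_fmeasurable fmeasurableD fmeasurable.finite_UN)
       (auto simp: measurable_translation)
  \<comment> \<open>The common factor \<open>measure lebesgue (K 1)\<close> is positive and
    cancels.\<close>
  finally have "card P * (\<delta> / 2) ^ card D \<le> (R + \<delta> / 2) ^ card D"
    using K1 K_scale[of "\<delta> / 2"] K_scale[of "R + \<delta> / 2"] R \<delta> by (simp add: mult.assoc[symmetric])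
  then have "card P \<le> (R + \<delta> / 2) ^ card D / (\<delta> / 2) ^ card D"
    using \<delta> by (subst pos_le_divide_eq) auto
  also have "\<dots> = ((R + \<delta> / 2) / (\<delta> / 2)) ^ card D"
    by (rule power_divide[symmetric])
  also have "(R + \<delta> / 2) / (\<delta> / 2) = 1 + 2 * R / \<delta>"
    using \<delta> by (simp add: field_simps)
  finally show ?thesis .
qed

text \<open>A linear isometry from a coordinate subspace of the same dimension onto \<open>S\<close>
  carries the problem back to the coordinate case, with \<open>\<nu> \<circ> f\<close> as the
  seminorm.\<close>

lemma separated_set_card_le:
  fixes \<nu> :: "'a::euclidean_space \<Rightarrow> real"
  assumes S: "subspace S"
    and tri: "\<And>x y. \<nu> (x + y) \<le> \<nu> x + \<nu> y"
    and scale: "\<And>a x. \<nu> (a *\<^sub>R x) = \<bar>a\<bar> * \<nu> x"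
    and upper: "\<And>x. \<nu> x \<le> C * norm x"
    and c: "c > 0" and lower: "\<And>x. x \<in> S \<Longrightarrow> c * norm x \<le> \<nu> x"
    and P: "finite P" "P \<subseteq> S" "\<And>x. x \<in> P \<Longrightarrow> \<nu> x \<le> R"
    and sep: "\<And>x y. x \<in> P \<Longrightarrow> y \<in> P \<Longrightarrow> x \<noteq> y \<Longrightarrow> \<nu> (x - y) > \<delta>"
    and \<delta>: "\<delta> > 0" and R: "R \<ge> 0"
  shows "real (card P) \<le> (1 + 2 * R / \<delta>) ^ dim S"
proof -
  obtain D :: "'a set" where D: "D \<subseteq> Basis" "card D = dim S"
    using dim_subset_UNIV[of S] by (metis obtain_subset_with_card_n)
  define E where "E = {x::'a. \<forall>i\<in>Basis. i \<notin> D \<longrightarrow> x \<bullet> i = 0}"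
  have E: "subspace E" "dim E = card D"
    unfolding E_def using subspace_substandard[of "\<lambda>i. i \<notin> D"] dim_substandard[OF D(1)]
    by auto
  obtain f where f: "linear f" "f ` E = S" "\<And>x. x \<in> E \<Longrightarrow> norm (f x) = norm x"
    using isometry_subspaces[OF E(1) S] E(2) D(2) by metis
  obtain Q where Q: "Q \<subseteq> E" "inj_on f Q" "P = f ` Q"
    using P(2) f(2) by (metis subset_image_inj)
  obtain B where B: "B > 0" "\<And>x. norm (f x) \<le> B * norm x"
    using linear_bounded_pos[OF f(1)] by blast
  have "real (card Q) \<le> (1 + 2 * R / \<delta>) ^ card D"
  \<comment> \<open>On \<open>E\<close> the map \<open>f\<close> preserves norms, so
    \<open>c\<close> is unchanged. The upper estimate is required on the whole space, where only
    \<open>norm (f x) \<le> B * norm x\<close> is at hand.\<close>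
  proof (rule separated_set_card_le_coordinate[where \<nu> = "\<nu> \<circ> f" and c = c and C = "\<bar>C\<bar> * B",
        OF D(1) E_def])
    fix x
    have "\<nu> (f x) \<le> C * norm (f x)"
      by (rule upper)
    also have "\<dots> \<le> \<bar>C\<bar> * (B * norm x)"
      using B(2)[of x] by (intro mult_mono) auto
    finally show "(\<nu> \<circ> f) x \<le> \<bar>C\<bar> * B * norm x"
      by (simp add: mult.assoc)
  next
    fix x assume "x \<in> E"
    then show "c * norm x \<le> (\<nu> \<circ> f) x"
      using lower[of "f x"] f(2,3) by auto
  next
    fix x y assume xy: "x \<in> Q" "y \<in> Q" "x \<noteq> y"
    then have "f x \<noteq> f y"
      using Q(2) by (auto dest: inj_onD)
    then show "(\<nu> \<circ> f) (x - y) > \<delta>"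
      using sep[of "f x" "f y"] xy Q(3) by (auto simp: linear_diff[OF f(1)])
  qed (use P Q tri scale c \<delta> R in \<open>auto simp: linear_add[OF f(1)] linear_scale[OF f(1)] finite_image_iff\<close>)
  then show ?thesis
    using Q D(2) by (simp add: card_image)
qed

section \<open>Nets from maximal separated sets\<close>

lemma finite_net_seminorm_ball:
  fixes \<nu> :: "'a::euclidean_space \<Rightarrow> real"
  assumes S: "subspace S"
    and tri: "\<And>x y. \<nu> (x + y) \<le> \<nu> x + \<nu> y"
    and scale: "\<And>a x. \<nu> (a *\<^sub>R x) = \<bar>a\<bar> * \<nu> x"
    and upper: "\<And>x. \<nu> x \<le> C * norm x"
    and c: "c > 0" and lower: "\<And>x. x \<in> S \<Longrightarrow> c * norm x \<le> \<nu> x"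
    and A: "A \<subseteq> S" "\<And>x. x \<in> A \<Longrightarrow> \<nu> x \<le> R"
    and \<delta>: "\<delta> > 0" and R: "R \<ge> 0"
  obtains P where "finite P" "P \<subseteq> A" "real (card P) \<le> (1 + 2 * R / \<delta>) ^ dim S"
    "\<And>x. x \<in> A \<Longrightarrow> \<exists>y\<in>P. \<nu> (x - y) \<le> \<delta>"
proof -
  define sep where "sep P \<longleftrightarrow> finite P \<and> P \<subseteq> A \<and>
    (\<forall>x\<in>P. \<forall>y\<in>P. x \<noteq> y \<longrightarrow> \<nu> (x - y) > \<delta>)" for P
  have bound: "real (card P) \<le> (1 + 2 * R / \<delta>) ^ dim S" if "sep P" for P
    using that A
    by (intro separated_set_card_le[OF S tri scale upper c lower _ _ _ _ \<delta> R])
       (auto simp: sep_def)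
  \<comment> \<open>Rounding down gives the natural-number bound from which a separated set of
    greatest cardinality is obtained.\<close>
  have "card P \<le> nat \<lfloor>(1 + 2 * R / \<delta>) ^ dim S\<rfloor>" if "sep P" for P
    using bound[OF that] by (simp add: le_nat_floor)
  moreover have "sep {}"
    by (simp add: sep_def)
  ultimately obtain P where P: "sep P" and max: "\<And>Q. sep Q \<Longrightarrow> card Q \<le> card P"
    using ex_has_greatest_nat[of sep "{}" card] by (metis le_imp_less_Suc)
  have minus: "\<nu> (- x) = \<nu> x" for x
    using scale[of "-1" x] by simp
  have "\<exists>y\<in>P. \<nu> (x - y) \<le> \<delta>" if x: "x \<in> A" for x
  proof (rule ccontr)
    assume "\<not> ?thesis"
    then have far: "\<nu> (x - y) > \<delta>" "\<nu> (y - x) > \<delta>" if "y \<in> P" for y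
      using that minus[of "x - y"] by (auto simp: not_le)
    have "\<nu> 0 = 0"
      using scale[of 0 0] by simp
    \<comment> \<open>Otherwise \<open>far\<close> at \<open>y = x\<close> would give
      \<open>\<nu> 0 > \<delta>\<close>. Hence inserting \<open>x\<close> strictly raises the
      cardinality.\<close>
    then have "x \<notin> P"
      using far(1)[of x] \<delta> by auto
    moreover have "sep (insert x P)"
      using P x far by (auto simp: sep_def)
    ultimately show False
      using max[of "insert x P"] P by (simp add: sep_def)
  qed
  with P show ?thesis
    by (intro that[of P] bound) (auto simp: sep_def)
qed

section \<open>Matrices with columns in a subspace\<close>

text \<open>The ambient linear space of the net. For a subspace \<open>V\<close> the columnwise
  condition agrees with \<open>span (columns W) \<subseteq> V\<close>, and its closure under linear
  operations is immediate.\<close>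

definition matrices_into :: "(real^'k) set \<Rightarrow> (real^'d^'k) set"
  where "matrices_into V = {W. \<forall>j. column j W \<in> V}"

lemma column_add: "column j (A + B) = column j A + column j B"
  by (simp add: column_def vec_eq_iff)

lemma column_scaleR: "column j (a *\<^sub>R A) = a *\<^sub>R column j A"
  by (simp add: column_def vec_eq_iff)

lemma subspace_matrices_into:
  assumes "subspace V"
  shows "subspace (matrices_into V :: (real^'d^'k) set)"
proof -
  have "column j (0 :: real^'d^'k) = 0" for j
    by (simp add: column_def vec_eq_iff)
  then show ?thesis
    using assms by (auto simp: subspace_def matrices_into_def column_add column_scaleR)
qed

text \<open>A matrix is the sum of its columns put back in place, and each column expands in a basis
  of \<open>V\<close>. So the matrices with one basis vector in one column and zeros elsewhere span
  the space.\<close>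

lemma dim_matrices_into_le:
  assumes "subspace V"
  shows "dim (matrices_into V :: (real^'d^'k) set) \<le> dim V * CARD('d)"
proof -
  obtain B where B: "B \<subseteq> V" "independent B" "V \<subseteq> span B" "card B = dim V"
    using basis_exists by blast
  have fB: "finite B"
    using B(2) by (simp add: independent_imp_finite)
  define E where "E j v = (\<chi> i l. if l = j then v $ i else 0)" for j :: 'd and v :: "real^'k"
  have E: "linear (E j)" for j
    by (rule linearI) (auto simp: E_def vec_eq_iff)
  define X where "X = (\<lambda>(v, j). E j v) ` (B \<times> UNIV)"
  have "matrices_into V \<subseteq> span X"
  proof
    fix W :: "real^'d^'k"
    assume W: "W \<in> matrices_into V"
    have "E j (column j W) \<in> span X" for j
    proof -
      have "E j (column j W) \<in> E j ` span B"
        using W B(3) by (auto simp: matrices_into_def)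
      also have "E j ` span B = span (E j ` B)"
        by (rule linear_span_image[OF E, symmetric])
      also have "\<dots> \<subseteq> span X"
        by (rule span_mono) (auto simp: X_def)
      finally show ?thesis .
    qed
    then have "(\<Sum>j\<in>UNIV. E j (column j W)) \<in> span X"
      by (intro span_sum)
    also have "(\<Sum>j\<in>UNIV. E j (column j W)) = W"
      by (simp add: vec_eq_iff E_def column_def if_distrib cong: if_cong)
    finally show "W \<in> span X" .
  qed
  then have "dim (matrices_into V :: (real^'d^'k) set) \<le> card X"
    using fB by (intro dim_le_card) (auto simp: X_def)
  also have "\<dots> \<le> card (B \<times> (UNIV :: 'd set))"
    unfolding X_def using fB by (intro card_image_le) auto
  finally show ?thesis
    using B(4) by (simp add: card_cartesian_product)
qed

section \<open>The operator norm as a norm on matrices\<close>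

text \<open>Every entry is at most the Euclidean norm in absolute value. The crude constant is
  harmless: the bound on the size of a net does not contain the constants that compare
  \<open>\<nu>\<close> with \<open>norm\<close>.\<close>

lemma onorm_matrix_le_norm:
  fixes W :: "real^'d^'k"
  shows "onorm ((*v) W) \<le> real CARD('k) * real CARD('d) * norm W"
proof (rule onorm_le_matrix_component)
  fix i j
  have "\<bar>W $ i $ j\<bar> \<le> norm (W $ i)"
    by (rule component_le_norm_cart)
  also have "\<dots> \<le> norm W"
    by (rule Finite_Cartesian_Product.norm_nth_le)
  finally show "\<bar>W $ i $ j\<bar> \<le> norm W" .
qed

text \<open>Every entry is at most the operator norm in absolute value, and the Euclidean norm is at
  most the sum of the absolute values of the entries.\<close>

lemma norm_le_onorm_matrix:
  fixes W :: "real^'d^'k"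
  shows "norm W \<le> real CARD('k) * real CARD('d) * onorm ((*v) W)"
proof -
  have "norm W \<le> (\<Sum>i\<in>UNIV. norm (W $ i))"
    by (simp add: norm_vec_def L2_set_le_sum)
  also have "\<dots> \<le> (\<Sum>i\<in>(UNIV::'k set). \<Sum>j\<in>(UNIV::'d set). onorm ((*v) W))"
  proof (rule sum_mono)
    fix i
    have "norm (W $ i) \<le> (\<Sum>j\<in>UNIV. \<bar>W $ i $ j\<bar>)"
      by (rule norm_le_l1_cart)
    also have "\<dots> \<le> (\<Sum>j\<in>(UNIV::'d set). onorm ((*v) W))"
      by (intro sum_mono matrix_component_le_onorm)
    finally show "norm (W $ i) \<le> (\<Sum>j\<in>(UNIV::'d set). onorm ((*v) W))" .
  qed
  finally show ?thesis
    by (simp add: mult.assoc)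
qed

lemma onorm_matrix_add:
  fixes A B :: "real^'d^'k"
  shows "onorm ((*v) (A + B)) \<le> onorm ((*v) A) + onorm ((*v) B)"
proof -
  have "(*v) (A + B) = (\<lambda>x. A *v x + B *v x)"
    by (simp add: fun_eq_iff matrix_vector_mult_add_rdistrib)
  then show ?thesis
    using onorm_triangle[of "(*v) A" "(*v) B"] by simp
qed

lemma onorm_matrix_scaleR:
  fixes A :: "real^'d^'k"
  shows "onorm ((*v) (a *\<^sub>R A)) = \<bar>a\<bar> * onorm ((*v) A)"
proof -
  have "(*v) (a *\<^sub>R A) = (\<lambda>x. a *\<^sub>R (A *v x))"
    by (simp add: fun_eq_iff scaleR_matrix_vector_assoc)
  then show ?thesis
    using onorm_scaleR[of "(*v) A" a] by simp
qed

section \<open>Covering number of the linear class\<close>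

text \<open>An operator-norm net of radius \<open>\<epsilon> / B\<^sub>x\<close> covers the
  functions within \<open>\<epsilon>\<close> on every admissible sample. The net is chosen before
  the sample, so its size also bounds the supremum over samples.\<close>

lemma covering_number_linear_class_le:
  fixes V :: "(real^'k) set"
  assumes V: "subspace V" and B\<^sub>w: "B\<^sub>w > 0" and B\<^sub>x: "B\<^sub>x > 0" and \<epsilon>: "\<epsilon> > 0"
  obtains m where "covering_number (linear_class V B\<^sub>w :: (real^'d \<Rightarrow> real^'k) set) \<epsilon> n B\<^sub>x \<le> enat m"
    "real m \<le> (1 + 2 * B\<^sub>w * B\<^sub>x / \<epsilon>) ^ (dim V * CARD('d))"
proof -
  let ?S = "matrices_into V :: (real^'d^'k) set"
  let ?A = "weight_class V B\<^sub>w :: (real^'d^'k) set"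
  define N where "N = real CARD('k) * real CARD('d)"
  have N: "N > 0"
    by (simp add: N_def)
  have \<delta>: "\<epsilon> / B\<^sub>x > 0"
    using B\<^sub>x \<epsilon> by simp
  have A: "?A \<subseteq> ?S"
  proof
    fix W assume "W \<in> ?A"
    then have "columns W \<subseteq> V"
      using span_superset[of "columns W"] by (auto simp: weight_class_def)
    then show "W \<in> ?S"
      by (auto simp: matrices_into_def columns_def)
  qed
  have lower: "1 / N * norm W \<le> onorm ((*v) W)" for W :: "real^'d^'k"
    using norm_le_onorm_matrix[of W] N unfolding N_def[symmetric] by (simp add: field_simps)
  have upper: "onorm ((*v) W) \<le> N * norm W" for W :: "real^'d^'k"
    unfolding N_def by (rule onorm_matrix_le_norm)
  have c: "1 / N > 0"
    using N by simp
  have R: "B\<^sub>w \<ge> 0"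
    using B\<^sub>w by simp
  have bound: "onorm ((*v) W) \<le> B\<^sub>w" if "W \<in> ?A" for W
    using that by (simp add: weight_class_def)
  obtain P where P: "finite P" "P \<subseteq> ?A" "real (card P) \<le> (1 + 2 * B\<^sub>w / (\<epsilon> / B\<^sub>x)) ^ dim ?S"
    "\<And>W. W \<in> ?A \<Longrightarrow> \<exists>W'\<in>P. onorm ((*v) (W - W')) \<le> \<epsilon> / B\<^sub>x"
    by (rule finite_net_seminorm_ball[where \<nu> = "\<lambda>W :: real^'d^'k. onorm ((*v) W)",
        OF subspace_matrices_into[OF V] onorm_matrix_add onorm_matrix_scaleR upper c lower A bound \<delta> R]) (assumption, rule that)
  \<comment> \<open>The indices of a cover in \<open>is_cover\<close> start at 1.\<close>
  obtain h where h: "bij_betw h {1..card P} P"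
    using ex_bij_betw_nat_finite_1[OF P(1)] by blast
  have "covering_number_on (linear_class V B\<^sub>w) \<epsilon> n x \<le> enat (card P)"
    if x: "\<forall>i\<in>{1..n}. norm (x i) \<le> B\<^sub>x" for x :: "nat \<Rightarrow> real^'d"
  proof -
    have "is_cover (linear_class V B\<^sub>w) \<epsilon> n x (card P) (\<lambda>j. (*v) (h j))"
      unfolding is_cover_def
    proof
      fix f assume "f \<in> (linear_class V B\<^sub>w :: (real^'d \<Rightarrow> real^'k) set)"
      then obtain W where W: "W \<in> ?A" and f: "f = (*v) W"
        by (auto simp: linear_class_def)
      obtain W' where W': "W' \<in> P" "onorm ((*v) (W - W')) \<le> \<epsilon> / B\<^sub>x"
        using P(4)[OF W] by blast
      have "W' \<in> h ` {1..card P}"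
        using W'(1) by (simp only: bij_betw_imp_surj_on[OF h])
      then obtain j where j: "W' = h j" "j \<in> {1..card P}"
        by (rule imageE)
      have "norm (f (x i) - W' *v x i) \<le> \<epsilon>" if i: "i \<in> {1..n}" for i
      proof -
        have "norm (f (x i) - W' *v x i) = norm ((W - W') *v x i)"
          by (simp add: f matrix_vector_mult_diff_rdistrib)
        also have "\<dots> \<le> onorm ((*v) (W - W')) * norm (x i)"
          by (rule onorm) simp
        also have "\<dots> \<le> \<epsilon> / B\<^sub>x * B\<^sub>x"
          using W'(2) x i \<delta> by (intro mult_mono) auto
        finally show ?thesis
          using B\<^sub>x by simp
      qed
      then have "\<forall>i\<in>{1..n}. norm (f (x i) - h j *v x i) \<le> \<epsilon>"
        unfolding j(1) by (rule ballI)
      then show "\<exists>j\<in>{1..card P}. \<forall>i\<in>{1..n}. norm (f (x i) - h j *v x i) \<le> \<epsilon>"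
        using j(2) by (rule bexI)
    qed
    then show ?thesis
      unfolding covering_number_on_def by (intro Inf_lower) blast
  qed
  then have "covering_number (linear_class V B\<^sub>w :: (real^'d \<Rightarrow> real^'k) set) \<epsilon> n B\<^sub>x \<le> enat (card P)"
    unfolding covering_number_def by (intro Sup_least) auto
  moreover have "real (card P) \<le> (1 + 2 * B\<^sub>w * B\<^sub>x / \<epsilon>) ^ (dim V * CARD('d))"
  proof -
    have "real (card P) \<le> (1 + 2 * B\<^sub>w * B\<^sub>x / \<epsilon>) ^ dim ?S"
      using P(3) by simp
    \<comment> \<open>The base is at least 1, so an upper bound on the dimension is enough.\<close>
    also have "\<dots> \<le> (1 + 2 * B\<^sub>w * B\<^sub>x / \<epsilon>) ^ (dim V * CARD('d))"
      using B\<^sub>w B\<^sub>x \<epsilon> by (intro power_increasing dim_matrices_into_le V) auto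
    finally show ?thesis .
  qed
  ultimately show ?thesis
    by (rule that)
qed

theorem theorem1:
  fixes V\<^sub>W :: "(real^'k::finite) set"
    and B\<^sub>w B\<^sub>x \<epsilon> :: real
    and n r\<^sub>w :: nat
  assumes "n > 0" and "B\<^sub>w > 0" and "B\<^sub>x > 0"
    and "subspace V\<^sub>W" and "dim V\<^sub>W = r\<^sub>w"
    and "\<epsilon> > 0"
  shows "ln_enat (covering_number (linear_class V\<^sub>W B\<^sub>w :: (real^'d::finite \<Rightarrow> real^'k) set) \<epsilon> n B\<^sub>x)
    \<le> ereal (real r\<^sub>w * real CARD('d) * ln (1 + 2 * B\<^sub>w * B\<^sub>x / \<epsilon>))"
proof -
  let ?b = "1 + 2 * B\<^sub>w * B\<^sub>x / \<epsilon>"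
  have b: "?b > 0"
    using assms by (simp add: add_pos_pos)
  obtain m where m: "covering_number (linear_class V\<^sub>W B\<^sub>w :: (real^'d \<Rightarrow> real^'k) set) \<epsilon> n B\<^sub>x \<le> enat m"
    "real m \<le> ?b ^ (r\<^sub>w * CARD('d))"
    using covering_number_linear_class_le[OF assms(4,2,3,6)] assms(5) by metis
  obtain m' where m': "covering_number (linear_class V\<^sub>W B\<^sub>w :: (real^'d \<Rightarrow> real^'k) set) \<epsilon> n B\<^sub>x = enat m'"
    "m' \<le> m"
    using m(1) by (cases "covering_number (linear_class V\<^sub>W B\<^sub>w :: (real^'d \<Rightarrow> real^'k) set) \<epsilon> n B\<^sub>x") auto
  \<comment> \<open>At 0 the value of \<open>ln_enat\<close> is \<open>- \<infinity>\<close> and the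
    bound is immediate, which leaves positive \<open>m'\<close>.\<close>
  have "ln (real m') \<le> real r\<^sub>w * real CARD('d) * ln ?b" if "m' > 0"
  proof -
    have "ln (real m') \<le> ln (?b ^ (r\<^sub>w * CARD('d)))"
      using that m(2) m'(2) b by (intro ln_mono) auto
    also have "\<dots> = real r\<^sub>w * real CARD('d) * ln ?b"
      using b by (simp add: ln_realpow)
    finally show ?thesis .
  qed
  then show ?thesis
    by (simp add: m'(1))
qed

end
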